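(* Let $\mathbb{F}$ be a field, $n\ge1$, let $G$ be a nonempty finite subgraph of $\mathrm{Path}_{\mathbb Z}$ with no isolated vertices, and let $A:[n]^{D(G)}\to\mathbb{F}$. Then $\mathcal L_{\mathsf{sm}}(A^\flat)\ge n^{\log_2\ell(G)}\,\rho(A)$.
   Context: $\mathrm{Path}_{\mathbb Z}$ has vertices $v_i$ ($i\in\mathbb Z$) and edges $\{v_{i-1},v_i\}$. For such $G$: $V_1(G),V_2(G)$ are the vertices of degree $1$ and $2$ in $G$; $D(G)=\{vw:\{v,w\}\in E(G)\}$ is the set of directed edges; $D_1(G)=\{vw\in D(G):v\in V_1(G)\}$. For $S\subseteq V(\mathrm{Path}_{\mathbb Z})$, $\mathcal P(S)$ is the set of pairs $\gamma=(I_\gamma,J_\gamma)$ of disjoint sets of directed edges of $\mathrm{Path}_{\mathbb Z}$, each with tail in $S$, such that for every $v\in S$ with $\mathrm{Path}_{\mathbb Z}$-neighbours $u,w$, one of $vu,vw$ lies in $I_\gamma$ and the other in $J_\gamma$. For $A:[n]^{D(G)}\to\mathbb{F}$, $\alpha\in\mathcal P(V_2(G))$, $\gamma\in\mathcal P(V_1(G))$: $\mathrm{relrk}_{\alpha,\gamma}(A)=n^{-|E(G)|}\mathrm{rank}\,\mathrm{Mat}_{I_\alpha\sqcup(I_\gamma\cap D_1(G)),\,J_\alpha\sqcup(J_\gamma\cap D_1(G))}(A)$, where $\mathrm{Mat}_{I,J}(A)$ is the flattening with rows indexed by $[n]^I$ and columns by $[n]^J$ (these two sets partition $D(G)$). Then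 $\rho(A)=\max_{\gamma\in\mathcal P(V_1(G))}\min\sum_{\alpha\in\mathcal P(V_2(G))}\mathrm{relrk}_{\alpha,\gamma}(X_\alpha)$, the minimum over families $X_\alpha:[n]^{D(G)}\to\mathbb{F}$ with $A=\sum_\alpha X_\alpha$. $A^\flat:[n^2]^{E(G)}\to\mathbb{F}$: $A^\flat(y)=A(x)$ where $y_{\{v_{i-1},v_i\}}=\langle x_{v_{i-1}v_i},x_{v_iv_{i-1}}\rangle$, with $\langle a,b\rangle=(a-1)n+b$. $\ell(G)$ is the maximal number of edges in a connected component of $G$. $\mathcal L_{\mathsf{sm}}$ of $B:[N]^D\to\mathbb{F}$ ($D$ finite nonempty): if $|D|=1$, it is $1$ if $B\ne0$, else $0$; if $|D|\ge2$, the minimum of $\sum_i(\mathcal L_{\mathsf{sm}}(B_i)+\mathcal L_{\mathsf{sm}}(C_i))$ over families with disjoint nonempty $E_i\cup F_i=D$, $B_i:[N]^{E_i}\to\mathbb{F}$, $C_i:[N]^{F_i}\to\mathbb{F}$, $B=\sum_iB_i\otimes C_i$. *)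

theory Defs
  imports Complex_Main "HOL-Library.FuncSet"
begin

(* Conventions.
   Vertex v_i of Path_Z is the integer i.  The edge {v_(i-1), v_i} is represented by the
   integer i.  A subgraph G is given by its vertex set V :: int set and edge set E :: int set.
   A directed edge v w is the pair (v, w) :: int \<times> int.
   [n]^D is the set of functions D \<rightarrow> {1..n} (extensional: undefined outside D). *)

definition cube :: "'d set \<Rightarrow> nat \<Rightarrow> ('d \<Rightarrow> nat) set" where
  "cube D n = PiE D (\<lambda>_. {1..n})"

definition path_subgraph :: "int set \<Rightarrow> int set \<Rightarrow> bool" where
  "path_subgraph V E \<longleftrightarrow> (\<forall>i\<in>E. i - 1 \<in> V \<and> i \<in> V)"

definition deg :: "int set \<Rightarrow> int \<Rightarrow> nat" where
  "deg E v = card {i\<in>E. i = v \<or> i = v + 1}"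

definition V1 :: "int set \<Rightarrow> int set \<Rightarrow> int set" where
  "V1 V E = {v\<in>V. deg E v = 1}"

definition V2 :: "int set \<Rightarrow> int set \<Rightarrow> int set" where
  "V2 V E = {v\<in>V. deg E v = 2}"

definition dedges :: "int set \<Rightarrow> (int \<times> int) set" where
  "dedges E = {(i - 1, i) | i. i \<in> E} \<union> {(i, i - 1) | i. i \<in> E}"

definition D1 :: "int set \<Rightarrow> int set \<Rightarrow> (int \<times> int) set" where
  "D1 V E = {d\<in>dedges E. fst d \<in> V1 V E}"

definition path_dedges :: "(int \<times> int) set" where
  "path_dedges = {(a, b). b = a + 1 \<or> a = b + 1}"

definition Pairs :: "int set \<Rightarrow> ((int \<times> int) set \<times> (int \<times> int) set) set" where
  "Pairs S = {(I, J). I \<subseteq> path_dedges \<and> J \<subseteq> path_dedges \<and> I \<inter> J = {} \<and>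
      (\<forall>d\<in>I \<union> J. fst d \<in> S) \<and>
      (\<forall>v\<in>S. ((v, v - 1) \<in> I \<and> (v, v + 1) \<in> J) \<or> ((v, v + 1) \<in> I \<and> (v, v - 1) \<in> J))}"

definition mat_rank :: "('r \<Rightarrow> 'c \<Rightarrow> 'f::field) \<Rightarrow> 'r set \<Rightarrow> 'c set \<Rightarrow> nat" where
  "mat_rank M R C = Max {card S | S. S \<subseteq> R \<and>
      (\<forall>a. (\<forall>c\<in>C. (\<Sum>r\<in>S. a r * M r c) = 0) \<longrightarrow> (\<forall>r\<in>S. a r = 0))}"

definition flattening_rank :: "nat \<Rightarrow> 'd set \<Rightarrow> 'd set \<Rightarrow> (('d \<Rightarrow> nat) \<Rightarrow> 'f::field) \<Rightarrow> nat" where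
  "flattening_rank n I J A =
     mat_rank (\<lambda>x y. A (\<lambda>d. if d \<in> I then x d else y d)) (cube I n) (cube J n)"

definition relrk :: "nat \<Rightarrow> int set \<Rightarrow> int set \<Rightarrow>
    ((int \<times> int) set \<times> (int \<times> int) set) \<Rightarrow> ((int \<times> int) set \<times> (int \<times> int) set) \<Rightarrow>
    ((int \<times> int \<Rightarrow> nat) \<Rightarrow> 'f::field) \<Rightarrow> real" where
  "relrk n V E \<alpha> \<gamma> A =
     real (flattening_rank n (fst \<alpha> \<union> (fst \<gamma> \<inter> D1 V E)) (snd \<alpha> \<union> (snd \<gamma> \<inter> D1 V E)) A)
       / real n ^ card E"

definition rho :: "nat \<Rightarrow> int set \<Rightarrow> int set \<Rightarrow> ((int \<times> int \<Rightarrow> nat) \<Rightarrow> 'f::field) \<Rightarrow> real" where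
  "rho n V E A = Max ((\<lambda>\<gamma>. Inf {(\<Sum>\<alpha>\<in>Pairs (V2 V E). relrk n V E \<alpha> \<gamma> (X \<alpha>)) | X.
        \<forall>x\<in>cube (dedges E) n. A x = (\<Sum>\<alpha>\<in>Pairs (V2 V E). X \<alpha> x)}) ` Pairs (V1 V E))"

(* A^\<flat> : [n^2]^{E(G)} \<rightarrow> F, using the inverse of \<langle>a,b\<rangle> = (a-1)n+b on [n]\<times>[n] *)
definition flat :: "nat \<Rightarrow> int set \<Rightarrow> ((int \<times> int \<Rightarrow> nat) \<Rightarrow> 'f) \<Rightarrow> (int \<Rightarrow> nat) \<Rightarrow> 'f" where
  "flat n E A y = A (\<lambda>d. if d \<in> dedges E then
       (if snd d = fst d + 1 then (y (snd d) - 1) div n + 1 else (y (fst d) - 1) mod n + 1)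
     else undefined)"

definition adj :: "int set \<Rightarrow> int \<Rightarrow> int \<Rightarrow> bool" where
  "adj E u w \<longleftrightarrow> (w = u + 1 \<and> w \<in> E) \<or> (u = w + 1 \<and> u \<in> E)"

definition component :: "int set \<Rightarrow> int \<Rightarrow> int set" where
  "component E v = {w. (adj E)\<^sup>*\<^sup>* v w}"

definition ell :: "int set \<Rightarrow> int set \<Rightarrow> nat" where
  "ell V E = Max ((\<lambda>v. card {i\<in>E. i - 1 \<in> component E v \<and> i \<in> component E v}) ` V)"

primrec lsm_aux :: "nat \<Rightarrow> nat \<Rightarrow> 'd set \<Rightarrow> (('d \<Rightarrow> nat) \<Rightarrow> 'f::field) \<Rightarrow> nat" where
  "lsm_aux 0 N D (B :: ('d \<Rightarrow> nat) \<Rightarrow> 'f) = (if \<exists>x\<in>cube D N. B x \<noteq> 0 then 1 else 0)"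
| "lsm_aux (Suc k) N D B =
     (if card D \<le> 1 then (if \<exists>x\<in>cube D N. B x \<noteq> 0 then 1 else 0)
      else Inf {(\<Sum>i<m. lsm_aux k N (Es i) (Bs i) + lsm_aux k N (Fs i) (Cs i)) | m Es Fs (Bs :: nat \<Rightarrow> ('d \<Rightarrow> nat) \<Rightarrow> 'f) (Cs :: nat \<Rightarrow> ('d \<Rightarrow> nat) \<Rightarrow> 'f).
                  (\<forall>i<m. Es i \<noteq> {} \<and> Fs i \<noteq> {} \<and> Es i \<inter> Fs i = {} \<and> Es i \<union> Fs i = D) \<and>
                  (\<forall>x\<in>cube D N. B x = (\<Sum>i<m. Bs i (restrict x (Es i)) * Cs i (restrict x (Fs i))))})"

definition lsm :: "nat \<Rightarrow> 'd set \<Rightarrow> (('d \<Rightarrow> nat) \<Rightarrow> 'f::field) \<Rightarrow> nat" where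
  "lsm N D B = lsm_aux (card D) N D B"

end

theory Submission
  imports Defs
begin

text \<open>Expand a formula for \<open>A\<^sup>\<flat>\<close> along a single branch, always entering the child whose
  edge set contains more edges of a longest component \<open>K\<close>. Each time both children meet \<open>K\<close>,
  the number of remaining edges of \<open>K\<close> is at most halved, while the partition of the edges
  gains a part meeting \<open>K\<close>. Since \<open>K\<close> is connected, the rows and columns at the vertices where
  two parts meet can be chosen so that all parts meeting \<open>K\<close> but one have different numbers
  of rows and columns. A product tensor over \<open>q + 1\<close> such parts then has relative rank at most
  \<open>n\<^sup>-\<^sup>q\<close> for a suitable \<open>\<alpha>\<close>, and \<open>q\<close> reaches \<open>log\<^sub>2 \<ell>(G)\<close> at a leaf. The bound is additive
  over the terms of the formula because decompositions \<open>A = \<Sum>\<^sub>\<alpha> X\<^sub>\<alpha>\<close> can be added.\<close>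

subsection \<open>Rank of matrices and flattenings\<close>

text \<open>Gaussian elimination, one equation \<open>z\<close> at a time: a row \<open>p\<close>
  with a nonzero entry at \<open>z\<close> serves as pivot. This removes one equation and one
  unknown, so the strict inequality persists.\<close>

lemma homogeneous_system_nontrivial:
  fixes P :: "'r \<Rightarrow> 'z \<Rightarrow> 'f::field"
  assumes "finite Z" "finite S" "card Z < card S"
  shows "\<exists>a. (\<exists>r\<in>S. a r \<noteq> 0) \<and> (\<forall>z\<in>Z. (\<Sum>r\<in>S. a r * P r z) = 0)"
  using assms
proof (induction Z arbitrary: S P rule: finite_induct)
  case empty
  then have "S \<noteq> {}" by auto
  then show ?case by (intro exI[of _ "\<lambda>_. 1"]) auto
next
  case (insert z Z)
  show ?case
  proof (cases "\<forall>r\<in>S. P r z = 0")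
    case True
    have "card Z < card S" using insert by simp
    from insert.IH[OF insert.prems(1) this, of P] obtain a where
      "\<exists>r\<in>S. a r \<noteq> 0" "\<forall>z\<in>Z. (\<Sum>r\<in>S. a r * P r z) = 0" by blast
    with True show ?thesis by (intro exI[of _ a]) auto
  next
    case False
    then obtain p where p: "p \<in> S" "P p z \<noteq> 0" by auto
    define S' where "S' = S - {p}"
    have S': "finite S'" "S = insert p S'" "p \<notin> S'"
      using p insert.prems by (auto simp: S'_def)
    have "card Z < card S'" using insert S' by simp
    \<comment> \<open>Every row but the pivot has its entry at \<open>z\<close> cleared;
      \<open>c\<close> below is the coefficient that the equation at \<open>z\<close> forces on the
      pivot row.\<close>
    define Q where "Q r w = P r w - P r z / P p z * P p w" for r w
    obtain a where a: "\<exists>r\<in>S'. a r \<noteq> 0" "\<forall>w\<in>Z. (\<Sum>r\<in>S'. a r * Q r w) = 0"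
      using insert.IH[OF S'(1) \<open>card Z < card S'\<close>, of Q] by blast
    define c where "c = - (\<Sum>r\<in>S'. a r * P r z) / P p z"
    define b where "b = a(p := c)"
    have b: "(\<Sum>r\<in>S. b r * P r w) = c * P p w + (\<Sum>r\<in>S'. a r * P r w)" for w
    proof -
      have "(\<Sum>r\<in>S'. b r * P r w) = (\<Sum>r\<in>S'. a r * P r w)"
        by (rule sum.cong) (use S' in \<open>auto simp: b_def\<close>)
      then show ?thesis using S' by (simp add: b_def)
    qed
    have Q: "(\<Sum>r\<in>S'. a r * Q r w) = (\<Sum>r\<in>S'. a r * P r w) + c * P p w" for w
      by (simp add: Q_def c_def right_diff_distrib sum_subtractf sum_divide_distrib
          sum_distrib_right mult.assoc)
    have "(\<Sum>r\<in>S. b r * P r w) = 0" if "w \<in> insert z Z" for w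
    proof (cases "w = z")
      case True
      then show ?thesis unfolding b using p by (simp add: c_def)
    next
      case False
      then show ?thesis unfolding b using a(2) that Q[of w] by (simp add: add.commute)
    qed
    moreover have "\<exists>r\<in>S. b r \<noteq> 0"
      using a(1) S' by (auto simp: b_def)
    ultimately show ?thesis by blast
  qed
qed

definition independent_rows :: "('r \<Rightarrow> 'c \<Rightarrow> 'f::field) \<Rightarrow> 'c set \<Rightarrow> 'r set \<Rightarrow> bool" where
  "independent_rows M C S \<longleftrightarrow> (\<forall>a. (\<forall>c\<in>C. (\<Sum>r\<in>S. a r * M r c) = 0) \<longrightarrow> (\<forall>r\<in>S. a r = 0))"

lemma mat_rank_attained:
  assumes "finite R"
  shows "\<exists>S\<subseteq>R. independent_rows M C S \<and> card S = mat_rank M R C"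
    and "\<lbrakk>S \<subseteq> R; independent_rows M C S\<rbrakk> \<Longrightarrow> card S \<le> mat_rank M R C"
proof -
  let ?K = "{card S | S. S \<subseteq> R \<and> independent_rows M C S}"
  have rank: "mat_rank M R C = Max ?K"
    by (simp add: mat_rank_def independent_rows_def)
  have "?K \<subseteq> card ` Pow R" by auto
  then have fin: "finite ?K" using assms by (meson finite_Pow_iff finite_imageI finite_subset)
  have "independent_rows M C {}" by (simp add: independent_rows_def)
  then have "?K \<noteq> {}" by blast
  from Max_in[OF fin this] show "\<exists>S\<subseteq>R. independent_rows M C S \<and> card S = mat_rank M R C"
    unfolding rank by force
  show "card S \<le> mat_rank M R C" if "S \<subseteq> R" "independent_rows M C S"
    unfolding rank using fin that by (intro Max_ge) auto
qed

text \<open>More than \<open>card Z\<close> independent rows would have a nontrivial combination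
  that vanishes on all columns of \<open>P\<close>, hence on all columns of the product
  \<open>M\<close>.\<close>

lemma mat_rank_le:
  assumes "finite R" "finite Z"
    and M: "\<And>r c. \<lbrakk>r \<in> R; c \<in> C\<rbrakk> \<Longrightarrow> M r c = (\<Sum>z\<in>Z. P r z * Q z c)"
  shows "mat_rank M R C \<le> card Z"
proof (rule ccontr)
  assume "\<not> ?thesis"
  moreover obtain S where S: "S \<subseteq> R" "independent_rows M C S" "card S = mat_rank M R C"
    using mat_rank_attained(1)[OF assms(1)] by metis
  ultimately have "card Z < card S" by simp
  moreover have "finite S" using S assms finite_subset by blast
  ultimately obtain a where a: "\<exists>r\<in>S. a r \<noteq> 0" "\<forall>z\<in>Z. (\<Sum>r\<in>S. a r * P r z) = 0"
    using homogeneous_system_nontrivial[of Z S P] assms by blast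
  have "(\<Sum>r\<in>S. a r * M r c) = 0" if "c \<in> C" for c
  proof -
    have "(\<Sum>r\<in>S. a r * M r c) = (\<Sum>r\<in>S. \<Sum>z\<in>Z. a r * P r z * Q z c)"
      using S that by (intro sum.cong) (auto simp: M sum_distrib_left mult.assoc)
    also have "\<dots> = (\<Sum>z\<in>Z. (\<Sum>r\<in>S. a r * P r z) * Q z c)"
      by (subst sum.swap) (simp add: sum_distrib_right)
    also have "\<dots> = 0" using a by simp
    finally show ?thesis .
  qed
  with a S show False unfolding independent_rows_def by blast
qed

text \<open>An independent set \<open>S\<close> of rows of maximal size works: adjoining another row
  gives a dependency in which that row has a nonzero coefficient, and dividing by it expresses the
  row through \<open>S\<close>.\<close>

lemma mat_rank_factorization:
  assumes "finite R"
  shows "\<exists>S P. finite S \<and> card S = mat_rank M R C \<and>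
    (\<forall>r\<in>R. \<forall>c\<in>C. M r c = (\<Sum>s\<in>S. P r s * M s c))"
proof -
  obtain S where S: "S \<subseteq> R" "independent_rows M C S" "card S = mat_rank M R C"
    using mat_rank_attained(1)[OF assms] by metis
  have finS: "finite S" using S assms finite_subset by blast
  have "\<exists>p. \<forall>c\<in>C. M r c = (\<Sum>s\<in>S. p s * M s c)" if r: "r \<in> R" for r
  proof (cases "r \<in> S")
    case True
    have "M r c = (\<Sum>s\<in>S. of_bool (s = r) * M s c)" for c
      using True finS by (subst sum.remove[of _ r]) auto
    then show ?thesis by (intro exI[of _ "\<lambda>s. of_bool (s = r)"]) blast
  next
    case False
    have "\<not> independent_rows M C (insert r S)"
      using mat_rank_attained(2)[OF assms, of "insert r S" M C] S r False finS by auto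
    then obtain a where a: "\<forall>c\<in>C. (\<Sum>s\<in>insert r S. a s * M s c) = 0"
        "\<exists>s\<in>insert r S. a s \<noteq> 0"
      unfolding independent_rows_def by blast
    have eq: "a r * M r c + (\<Sum>s\<in>S. a s * M s c) = 0" if "c \<in> C" for c
      using a(1) that False finS by simp
    have ar: "a r \<noteq> 0"
    proof
      assume "a r = 0"
      then show False using eq a(2) S(2) unfolding independent_rows_def by auto
    qed
    have "M r c = (\<Sum>s\<in>S. (- a s / a r) * M s c)" if "c \<in> C" for c
    proof -
      have "M r c = - (\<Sum>s\<in>S. a s * M s c) / a r"
        using eq[OF that] ar by (simp add: field_simps eq_neg_iff_add_eq_0)
      then show ?thesis by (simp add: sum_divide_distrib sum_negf)
    qed
    then show ?thesis by (intro exI[of _ "\<lambda>s. - a s / a r"]) blast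
  qed
  then obtain P where "\<forall>r\<in>R. \<forall>c\<in>C. M r c = (\<Sum>s\<in>S. P r s * M s c)"
    by metis
  with S finS show ?thesis by blast
qed

text \<open>The two factorizations are placed side by side, over the disjoint sum of their inner
  index sets.\<close>

lemma mat_rank_add:
  assumes "finite R"
  shows "mat_rank (\<lambda>r c. M r c + N r c) R C \<le> mat_rank M R C + mat_rank N R C"
proof -
  obtain S P where S: "finite S" "card S = mat_rank M R C"
      "\<forall>r\<in>R. \<forall>c\<in>C. M r c = (\<Sum>s\<in>S. P r s * M s c)"
    using mat_rank_factorization[OF assms, of M C] by blast
  obtain T Q where T: "finite T" "card T = mat_rank N R C"
      "\<forall>r\<in>R. \<forall>c\<in>C. N r c = (\<Sum>s\<in>T. Q r s * N s c)"
    using mat_rank_factorization[OF assms, of N C] by blast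
  have "mat_rank (\<lambda>r c. M r c + N r c) R C \<le> card (S <+> T)"
    by (rule mat_rank_le[where P = "\<lambda>r z. case z of Inl s \<Rightarrow> P r s | Inr t \<Rightarrow> Q r t"
          and Q = "\<lambda>z c. case z of Inl s \<Rightarrow> M s c | Inr t \<Rightarrow> N t c"])
      (use assms S T in \<open>auto simp: sum.Plus\<close>)
  then show ?thesis using S T by (simp add: card_Plus)
qed

section \<open>Ranks of flattened tensors\<close>

lemma finite_cube: "finite D \<Longrightarrow> finite (cube D n)"
  by (simp add: cube_def finite_PiE)

lemma card_cube: "finite D \<Longrightarrow> card (cube D n) = n ^ card D"
  by (simp add: cube_def card_PiE)

lemma flattening_rank_zero:
  assumes "finite I"
  shows "flattening_rank n I J (\<lambda>x. 0) = 0"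
  unfolding flattening_rank_def
  using mat_rank_le[of "cube I n" "{}::nat set" "cube J n" "\<lambda>x y. 0"] finite_cube[OF assms]
  by simp

lemma flattening_rank_sum:
  fixes m :: nat
  assumes "finite I"
  shows "flattening_rank n I J (\<lambda>x. \<Sum>i<m. X i x) \<le> (\<Sum>i<m. flattening_rank n I J (X i))"
proof (induction m)
  case 0
  then show ?case using flattening_rank_zero[OF assms] by simp
next
  case (Suc m)
  have "flattening_rank n I J (\<lambda>x. (\<Sum>i<m. X i x) + X m x)
      \<le> flattening_rank n I J (\<lambda>x. \<Sum>i<m. X i x) + flattening_rank n I J (X m)"
    unfolding flattening_rank_def by (rule mat_rank_add[OF finite_cube[OF assms]])
  with Suc show ?case by simp
qed

text \<open>The set \<open>W\<close> holds one side of every factor; fixing the coordinates in \<open>W\<close> makes each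
  factor depend on the row index alone or on the column index alone.\<close>

lemma flattening_rank_prod_le:
  fixes A :: "('d \<Rightarrow> nat) \<Rightarrow> 'f::field"
  assumes fin: "finite PP" "finite I" "finite J" and disj: "I \<inter> J = {}"
    and W: "\<And>P. P \<in> PP \<Longrightarrow> I \<inter> T P \<subseteq> W \<or> J \<inter> T P \<subseteq> W" "W \<subseteq> I \<union> J"
    and T: "\<And>P. P \<in> PP \<Longrightarrow> T P \<subseteq> I \<union> J"
    and g: "\<And>P x y. \<lbrakk>P \<in> PP; \<And>d. d \<in> T P \<Longrightarrow> x d = y d\<rbrakk> \<Longrightarrow> g P x = g P y"
    and A: "\<And>x. x \<in> cube (I \<union> J) n \<Longrightarrow> A x = (\<Prod>P\<in>PP. g P x)"
  shows "flattening_rank n I J A \<le> n ^ card W"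
proof -
  define mix where "mix x y d = (if d \<in> I then x d else y d)" for x y :: "'d \<Rightarrow> nat" and d
  define P1 where "P1 = {P\<in>PP. I \<inter> T P \<subseteq> W}"
  \<comment> \<open>The inner index \<open>z\<close> ranges over the values on \<open>W\<close>. The
    indicators in \<open>p\<close> and \<open>q\<close> make it agree with \<open>r\<close> on the
    row part of \<open>W\<close> and with \<open>c\<close> on the column part, so only
    \<open>z0\<close> survives. Factors in \<open>P1\<close> have all their row coordinates in
    \<open>W\<close> and depend on \<open>z\<close> and \<open>c\<close> only; the others depend on
    \<open>r\<close> and \<open>z\<close> only.\<close>
  define p where "p r z = of_bool (\<forall>d\<in>W \<inter> I. z d = r d) * (\<Prod>P\<in>PP - P1. g P (mix r z))" for r z
  define q where "q z c = of_bool (\<forall>d\<in>W - I. z d = c d) * (\<Prod>P\<in>P1. g P (mix z c))" for z c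
  have finW: "finite W" using W(2) fin finite_subset by blast
  have "A (mix r c) = (\<Sum>z\<in>cube W n. p r z * q z c)"
    if rc: "r \<in> cube I n" "c \<in> cube J n" for r c
  proof -
    define z0 where "z0 = restrict (mix r c) W"
    have mix: "mix r c \<in> cube (I \<union> J) n"
      using rc by (auto simp: cube_def mix_def PiE_iff extensional_def)
    then have z0: "z0 \<in> cube W n"
      using W(2) by (auto simp: z0_def cube_def PiE_iff)
    have "p r z * q z c = 0" if z: "z \<in> cube W n" "z \<noteq> z0" for z
    proof -
      have "\<exists>d\<in>W. z d \<noteq> z0 d"
        using z z0 PiE_ext[of z W _ z0] unfolding cube_def by blast
      then show ?thesis by (auto simp: p_def q_def z0_def mix_def split: if_splits)
    qed
    then have "(\<Sum>z\<in>cube W n. p r z * q z c) = (\<Sum>z\<in>{z0}. p r z * q z c)"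
      using z0 finite_cube[OF finW] by (intro sum.mono_neutral_right) auto
    also have "\<dots> = (\<Prod>P\<in>PP - P1. g P (mix r z0)) * (\<Prod>P\<in>P1. g P (mix z0 c))"
      by (auto simp: p_def q_def z0_def mix_def)
    also have "(\<Prod>P\<in>PP - P1. g P (mix r z0)) = (\<Prod>P\<in>PP - P1. g P (mix r c))"
    proof (rule prod.cong[OF refl], rule g)
      fix P d assume P: "P \<in> PP - P1" and d: "d \<in> T P"
      then have "J \<inter> T P \<subseteq> W" "d \<in> I \<union> J" using W(1)[of P] T[of P] by (auto simp: P1_def)
      then show "mix r z0 d = mix r c d" using d by (auto simp: mix_def z0_def)
    qed simp
    also have "(\<Prod>P\<in>P1. g P (mix z0 c)) = (\<Prod>P\<in>P1. g P (mix r c))"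
    proof (rule prod.cong[OF refl], rule g)
      fix P d assume "P \<in> P1" "d \<in> T P"
      then show "mix z0 c d = mix r c d" by (auto simp: mix_def z0_def P1_def)
    qed (auto simp: P1_def)
    also have "(\<Prod>P\<in>PP - P1. g P (mix r c)) * (\<Prod>P\<in>P1. g P (mix r c)) = A (mix r c)"
      using prod.subset_diff[of P1 PP "\<lambda>P. g P (mix r c)"] fin A[OF mix] by (simp add: P1_def)
    finally show ?thesis by simp
  qed
  then have "mat_rank (\<lambda>r c. A (mix r c)) (cube I n) (cube J n) \<le> card (cube W n)"
    by (rule mat_rank_le[OF finite_cube[OF fin(2)] finite_cube[OF finW]])
  then show ?thesis
    by (simp add: flattening_rank_def card_cube[OF finW] mix_def[abs_def])
qed

subsection \<open>Set-multilinear formulas\<close>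

text \<open>A nonempty set of natural numbers contains its infimum, so it suffices to exhibit one
  admissible decomposition; \<open>card D \<ge> 2\<close> leaves room for two nonempty
  sides.\<close>

lemma lsm_aux_Suc_attained:
  fixes B :: "('d \<Rightarrow> nat) \<Rightarrow> 'f::field"
  assumes "card D \<ge> 2"
  shows "\<exists>m Es Fs (Bs :: nat \<Rightarrow> ('d \<Rightarrow> nat) \<Rightarrow> 'f) (Cs :: nat \<Rightarrow> ('d \<Rightarrow> nat) \<Rightarrow> 'f).
    (\<forall>i<m. Es i \<noteq> {} \<and> Fs i \<noteq> {} \<and> Es i \<inter> Fs i = {} \<and> Es i \<union> Fs i = D) \<and>
    (\<forall>x\<in>cube D N. B x = (\<Sum>i<m. Bs i (restrict x (Es i)) * Cs i (restrict x (Fs i)))) \<and>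
    lsm_aux (Suc k) N D B = (\<Sum>i<m. lsm_aux k N (Es i) (Bs i) + lsm_aux k N (Fs i) (Cs i))"
proof -
  let ?good = "\<lambda>m Es Fs (Bs :: nat \<Rightarrow> ('d \<Rightarrow> nat) \<Rightarrow> 'f) (Cs :: nat \<Rightarrow> ('d \<Rightarrow> nat) \<Rightarrow> 'f).
    (\<forall>i<m. Es i \<noteq> {} \<and> Fs i \<noteq> {} \<and> Es i \<inter> Fs i = {} \<and> Es i \<union> Fs i = D) \<and>
    (\<forall>x\<in>cube D N. B x = (\<Sum>i<m. Bs i (restrict x (Es i)) * Cs i (restrict x (Fs i))))"
  let ?S = "{(\<Sum>i<m. lsm_aux k N (Es i) (Bs i) + lsm_aux k N (Fs i) (Cs i)) | m Es Fs Bs Cs.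
    ?good m Es Fs Bs Cs}"
  have fin: "finite D" using assms card.infinite by fastforce
  obtain d where d: "d \<in> D" using assms by fastforce
  have "D - {d} \<noteq> {}"
  proof
    assume "D - {d} = {}"
    then have "card D \<le> card {d}" by (intro card_mono) auto
    then show False using assms by simp
  qed
  \<comment> \<open>\<open>h\<close> enumerates the points of the cube. Term \<open>i\<close> is
    \<open>B (h i)\<close> times the indicator of the point \<open>h i\<close>, which factors into
    an indicator on \<open>{d}\<close> and one on the remaining coordinates.\<close>
  obtain h where h: "bij_betw h {..<card (cube D N)} (cube D N)"
    using ex_bij_betw_nat_finite[OF finite_cube[OF fin], of N] by (auto simp: atLeast0LessThan)
  have "B x = (\<Sum>i<card (cube D N). (of_bool (restrict x {d} = restrict (h i) {d}) * B (h i))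
      * of_bool (restrict x (D - {d}) = restrict (h i) (D - {d})))" if x: "x \<in> cube D N" for x
  proof -
    have eq: "restrict x {d} = restrict y {d} \<and> restrict x (D - {d}) = restrict y (D - {d}) \<longleftrightarrow> x = y"
      if y: "y \<in> cube D N" for y
    proof
      assume "restrict x {d} = restrict y {d} \<and> restrict x (D - {d}) = restrict y (D - {d})"
      then have "x e = y e" if "e \<in> D" for e
        using that by (metis Diff_iff restrict_apply' singleton_iff)
      then show "x = y" using x y unfolding cube_def by (intro PiE_ext)
    qed simp
    have "(\<Sum>i<card (cube D N). (of_bool (restrict x {d} = restrict (h i) {d}) * B (h i))
        * of_bool (restrict x (D - {d}) = restrict (h i) (D - {d})))
      = (\<Sum>y\<in>cube D N. (of_bool (restrict x {d} = restrict y {d}) * B y)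
        * of_bool (restrict x (D - {d}) = restrict y (D - {d})))"
      by (rule sum.reindex_bij_betw[OF h])
    also have "\<dots> = (\<Sum>y\<in>cube D N. if x = y then B y else 0)"
      using eq by (intro sum.cong) auto
    also have "\<dots> = B x" using x finite_cube[OF fin] by simp
    finally show ?thesis by simp
  qed
  then have "?good (card (cube D N)) (\<lambda>_. {d}) (\<lambda>_. D - {d})
      (\<lambda>i u. of_bool (u = restrict (h i) {d}) * B (h i))
      (\<lambda>i u. of_bool (u = restrict (h i) (D - {d})))"
    using d \<open>D - {d} \<noteq> {}\<close> by auto
  note good = this
  have "?S \<noteq> {}" if "?good m Es Fs Bs Cs" for m Es Fs Bs Cs
  proof -
    have "(\<Sum>i<m. lsm_aux k N (Es i) (Bs i) + lsm_aux k N (Fs i) (Cs i)) \<in> ?S"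
      by (rule CollectI, rule exI[of _ m], rule exI[of _ Es], rule exI[of _ Fs], rule exI[of _ Bs],
          rule exI[of _ Cs]) (rule conjI[OF refl that])
    then show ?thesis by (metis empty_iff)
  qed
  from this[OF good] have "Inf ?S \<in> ?S" by (rule Inf_nat_def1)
  moreover have "lsm_aux (Suc k) N D B = Inf ?S"
    unfolding lsm_aux.simps(2) by (rule if_not_P) (use assms in linarith)
  ultimately have "lsm_aux (Suc k) N D B \<in> ?S" by (simp only:)
  then obtain m :: nat and Es Fs Bs Cs where
    lsm: "lsm_aux (Suc k) N D B = (\<Sum>i<m. lsm_aux k N (Es i) (Bs i) + lsm_aux k N (Fs i) (Cs i))"
    and g: "?good m Es Fs Bs Cs"
    by (elim CollectE exE conjE) (rule that, assumption, rule conjI, assumption+)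
  show ?thesis
    by (intro exI) (rule conjI[OF conjunct1[OF g] conjI[OF conjunct2[OF g] lsm]])
qed

subsection \<open>Paths and their orientations\<close>

lemma finite_dedges: "finite P \<Longrightarrow> finite (dedges P)"
  unfolding dedges_def by (intro finite_UnI) (auto simp: setcompr_eq_image)

lemma card_dedges:
  assumes "finite P"
  shows "card (dedges P) = 2 * card P"
proof -
  have d: "dedges P = (\<lambda>i. (i - 1, i)) ` P \<union> (\<lambda>i. (i, i - 1)) ` P"
    by (auto simp: dedges_def)
  have "card (dedges P) = card ((\<lambda>i. (i - 1, i)) ` P) + card ((\<lambda>i. (i, i - 1)) ` P)"
    unfolding d by (rule card_Un_disjoint) (use assms in auto)
  also have "\<dots> = 2 * card P"
    by (subst (1 2) card_image) (auto simp: inj_on_def)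
  finally show ?thesis .
qed

lemma deg_eq: "deg E v = of_bool (v \<in> E) + of_bool (v + 1 \<in> E)"
proof -
  have "{i\<in>E. i = v \<or> i = v + 1} = (if v \<in> E then {v} else {}) \<union> (if v + 1 \<in> E then {v + 1} else {})"
    by auto
  then show ?thesis by (simp add: deg_def)
qed

text \<open>Each step of a walk crosses one edge and moves by one vertex, so no edge between the
  ends is skipped. As edge \<open>i\<close> joins \<open>i - 1\<close> and \<open>i\<close>, these
  edges form an interval open on the left.\<close>

lemma adj_rtranclp_edges:
  assumes "(adj E)\<^sup>*\<^sup>* v w"
  shows "{min v w<..max v w} \<subseteq> E"
  using assms
proof (induction rule: rtranclp_induct)
  case (step u w)
  then have "w = u + 1 \<and> w \<in> E \<or> u = w + 1 \<and> u \<in> E" by (simp add: adj_def)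
  then have "{min v w<..max v w} \<subseteq> {min v u<..max v u} \<union> (if w = u + 1 then {w} else {u})"
    by (auto simp: min_def max_def split: if_splits)
  with step show ?case by (auto simp: adj_def split: if_splits)
qed simp

text \<open>The edges of a component attaining the maximum leave no gap between the smallest and the
  largest one, because a walk joins the outer ends of these two.\<close>

lemma longest_interval:
  assumes "finite V" "V \<noteq> {}" "path_subgraph V E" "\<forall>v\<in>V. deg E v \<ge> 1"
  shows "\<exists>a b. a \<le> b \<and> {a..b} \<subseteq> E \<and> 1 \<le> ell V E \<and> ell V E \<le> card {a..b}"
proof -
  define K where "K v = {i\<in>E. i - 1 \<in> component E v \<and> i \<in> component E v}" for v
  have "E \<subseteq> V" using assms(3) by (auto simp: path_subgraph_def)
  then have finE: "finite E" using assms(1) finite_subset by blast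
  have ell: "ell V E = Max ((\<lambda>v. card (K v)) ` V)" by (simp add: ell_def K_def)
  have "ell V E \<in> (\<lambda>v. card (K v)) ` V"
    unfolding ell using assms(1,2) by (intro Max_in) auto
  then obtain v where v: "v \<in> V" "card (K v) = ell V E" by auto
  obtain u where u: "u \<in> V" using assms(2) by auto
  \<comment> \<open>A vertex \<open>u\<close> of positive degree lies on edge \<open>u\<close> or on
    edge \<open>u + 1\<close>, so its component has an edge and \<open>ell V E\<close> is
    positive.\<close>
  have "K u \<noteq> {}"
  proof (cases "u \<in> E")
    case True
    then have "adj E u (u - 1)" by (simp add: adj_def)
    then have "u \<in> K u" using True by (auto simp: K_def component_def)
    then show ?thesis by auto
  next
    case False
    moreover have "1 \<le> deg E u" using assms(4) u by simp
    ultimately have "u + 1 \<in> E" by (cases "u + 1 \<in> E") (simp_all add: deg_eq)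
    then have "adj E u (u + 1)" by (simp add: adj_def)
    then have "u + 1 \<in> K u" using \<open>u + 1 \<in> E\<close> by (auto simp: K_def component_def)
    then show ?thesis by auto
  qed
  moreover have finK: "finite (K w)" for w using finE by (simp add: K_def)
  ultimately have "1 \<le> card (K u)" by (simp add: Suc_le_eq card_gt_0_iff)
  also have "\<dots> \<le> ell V E" unfolding ell using u assms(1) by (intro Max_ge) auto
  finally have ge1: "1 \<le> ell V E" .
  then have ne: "K v \<noteq> {}" using v by auto
  define a b where "a = Min (K v)" and "b = Max (K v)"
  have ab: "a \<in> K v" "b \<in> K v" "K v \<subseteq> {a..b}"
    using Min_in[OF finK ne] Max_in[OF finK ne] finK by (auto simp: a_def b_def)
  have "symp (adj E)" by (auto simp: symp_def adj_def)
  then have "symp (adj E)\<^sup>*\<^sup>*" by (rule symp_rtranclp)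
  moreover have "(adj E)\<^sup>*\<^sup>* v (a - 1)" "(adj E)\<^sup>*\<^sup>* v b"
    using ab by (auto simp: K_def component_def)
  ultimately have "(adj E)\<^sup>*\<^sup>* (a - 1) b" by (meson rtranclp_trans sympD)
  from adj_rtranclp_edges[OF this] have "{a..b} \<subseteq> E" using ab by auto
  moreover have "ell V E \<le> card {a..b}" using v ab card_mono[of "{a..b}" "K v"] by simp
  moreover have "a \<le> b" using ab by auto
  ultimately show ?thesis using ge1 by blast
qed

section \<open>Choices of rows and columns at the vertices\<close>

lemma finite_Pairs: "finite S \<Longrightarrow> finite (Pairs S)"
proof -
  assume "finite S"
  define U where "U = (\<lambda>v. (v, v + 1)) ` S \<union> (\<lambda>v::int. (v, v - 1)) ` S"
  have "Pairs S \<subseteq> Pow U \<times> Pow U"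
  proof
    fix p assume "p \<in> Pairs S"
    then have "fst p \<union> snd p \<subseteq> path_dedges" "\<forall>d\<in>fst p \<union> snd p. fst d \<in> S"
      by (auto simp: Pairs_def)
    then have "fst p \<union> snd p \<subseteq> U" by (force simp: path_dedges_def U_def image_iff)
    then show "p \<in> Pow U \<times> Pow U" by (cases p) auto
  qed
  moreover have "finite U" using \<open>finite S\<close> by (simp add: U_def)
  ultimately show ?thesis by (meson finite_Pow_iff finite_SigmaI finite_subset)
qed

lemma Pairs_nonempty: "Pairs S \<noteq> {}"
proof -
  have "({(v, v + 1) | v. v \<in> S}, {(v, v - 1) | v. v \<in> S}) \<in> Pairs S"
    by (auto simp: Pairs_def path_dedges_def)
  then show ?thesis by blast
qed

text \<open>The bound is proved for every \<gamma> separately, which takes care of the maximum in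
  \<open>rho\<close>; hence \<gamma> can be fixed in the context.\<close>

locale oriented_path =
  fixes n :: nat and V E :: "int set" and \<gamma> :: "(int \<times> int) set \<times> (int \<times> int) set"
  assumes n: "n \<ge> 1"
    and finite_V: "finite V"
    and subgraph: "path_subgraph V E"
    and deg_ge: "\<forall>v\<in>V. deg E v \<ge> 1"
    and \<gamma>: "\<gamma> \<in> Pairs (V1 V E)"
begin

lemma finite_E: "finite E"
  using subgraph finite_V finite_subset[of E V] by (auto simp: path_subgraph_def)

text \<open>\<open>s v\<close> says that the edge leading from \<open>v\<close> to \<open>v + 1\<close> is a row; it is ignored
  at vertices of degree 1, where \<open>\<gamma>\<close> decides.\<close>

definition row :: "(int \<Rightarrow> bool) \<Rightarrow> int \<times> int \<Rightarrow> bool" where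
  "row s d \<longleftrightarrow> (if fst d \<in> V2 V E then (snd d = fst d + 1) = s (fst d) else d \<in> fst \<gamma>)"

definition orient :: "(int \<Rightarrow> bool) \<Rightarrow> (int \<times> int) set \<times> (int \<times> int) set" where
  "orient s = ({d\<in>path_dedges. fst d \<in> V2 V E \<and> row s d}, {d\<in>path_dedges. fst d \<in> V2 V E \<and> \<not> row s d})"

definition rows :: "(int \<Rightarrow> bool) \<Rightarrow> int set \<Rightarrow> (int \<times> int) set" where
  "rows s P = {d\<in>dedges P. row s d}"

definition cols :: "(int \<Rightarrow> bool) \<Rightarrow> int set \<Rightarrow> (int \<times> int) set" where
  "cols s P = {d\<in>dedges P. \<not> row s d}"

lemma orient_in_Pairs: "orient s \<in> Pairs (V2 V E)"
  by (auto simp: orient_def Pairs_def path_dedges_def row_def)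

lemma V2_iff: "v \<in> V2 V E \<longleftrightarrow> v \<in> E \<and> v + 1 \<in> E"
  using subgraph by (auto simp: V2_def deg_eq path_subgraph_def of_bool_def split: if_splits)

lemma V1_iff: "v \<in> V1 V E \<longleftrightarrow> (v \<in> E) \<noteq> (v + 1 \<in> E)"
proof -
  have "v + 1 \<in> E \<Longrightarrow> v \<in> V" using subgraph by (force simp: path_subgraph_def)
  then show ?thesis
    using subgraph by (auto simp: V1_def deg_eq path_subgraph_def of_bool_def split: if_splits)
qed

lemma mem_dedges: "(v, w) \<in> dedges P \<longleftrightarrow> (w = v + 1 \<and> v + 1 \<in> P) \<or> (w = v - 1 \<and> v \<in> P)"
  by (auto simp: dedges_def)

text \<open>Both ends of an edge of \<open>E\<close> have degree 1 or 2, so each directed edge gets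
  its side from exactly one of \<gamma> and \<open>s\<close>. This lets the single predicate
  \<open>row s\<close> describe the flattening in \<open>relrk\<close>.\<close>

lemma orient_dedges:
  shows "fst (orient s) \<union> (fst \<gamma> \<inter> D1 V E) = rows s E"
    and "snd (orient s) \<union> (snd \<gamma> \<inter> D1 V E) = cols s E"
proof -
  have \<gamma>': "fst \<gamma> \<inter> snd \<gamma> = {}"
    "\<And>v. v \<in> V1 V E \<Longrightarrow> ((v, v - 1) \<in> fst \<gamma> \<and> (v, v + 1) \<in> snd \<gamma>) \<or> ((v, v + 1) \<in> fst \<gamma> \<and> (v, v - 1) \<in> snd \<gamma>)"
    using \<gamma> by (auto simp: Pairs_def)
  have "(v, w) \<in> fst (orient s) \<union> (fst \<gamma> \<inter> D1 V E) \<longleftrightarrow> (v, w) \<in> rows s E" for v w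
    by (auto simp: orient_def rows_def row_def D1_def path_dedges_def mem_dedges V1_iff V2_iff)
  then show "fst (orient s) \<union> (fst \<gamma> \<inter> D1 V E) = rows s E" by auto
  have "(v, w) \<in> snd (orient s) \<union> (snd \<gamma> \<inter> D1 V E) \<longleftrightarrow> (v, w) \<in> cols s E" for v w
    using \<gamma>'(1) \<gamma>'(2)[of v]
    by (auto simp: orient_def cols_def row_def D1_def path_dedges_def mem_dedges V1_iff V2_iff)
  then show "snd (orient s) \<union> (snd \<gamma> \<inter> D1 V E) = cols s E" by auto
qed

lemma relrk_orient:
  "relrk n V E (orient s) \<gamma> A = real (flattening_rank n (rows s E) (cols s E) A) / real n ^ card E"
  by (simp add: relrk_def orient_dedges)

lemma card_rows_cols:
  assumes "finite P"
  shows "card (rows s P) + card (cols s P) = 2 * card P"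
proof -
  have "card (rows s P) + card (cols s P) = card (rows s P \<union> cols s P)"
    using finite_dedges[OF assms]
    by (intro card_Un_disjoint[symmetric]) (auto simp: rows_def cols_def)
  also have "rows s P \<union> cols s P = dedges P" by (auto simp: rows_def cols_def)
  finally show ?thesis using card_dedges[OF assms] by simp
qed

section \<open>Parts with different numbers of rows and columns\<close>

definition unbalanced :: "(int \<Rightarrow> bool) \<Rightarrow> int set \<Rightarrow> bool" where
  "unbalanced s P \<longleftrightarrow> card (rows s P) \<noteq> card (cols s P)"

text \<open>Of the two directed edges with tail \<open>v\<close>, only \<open>(v, v + 1)\<close>
  belongs to \<open>dedges P\<close>. Flipping \<open>s v\<close> moves it to the other side and
  changes the difference between rows and columns by two, so the numbers cannot agree both
  times.\<close>

lemma unbalanced_flip: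
  assumes "finite P" "v \<in> E" "v + 1 \<in> E" "v + 1 \<in> P" "v \<notin> P"
  shows "unbalanced s P \<or> unbalanced (s(v := \<not> s v)) P"
proof -
  have *: "unbalanced (s(v := False)) P \<or> unbalanced (s(v := True)) P"
  proof -
    let ?s0 = "s(v := False)" and ?s1 = "s(v := True)"
    have v: "v \<in> V2 V E" using assms V2_iff by simp
    have "rows ?s1 P = insert (v, v + 1) (rows ?s0 P)"
      using v assms(4,5) by (auto simp: rows_def row_def mem_dedges)
    moreover have "(v, v + 1) \<notin> rows ?s0 P" using v by (simp add: rows_def row_def)
    moreover have "cols ?s0 P = insert (v, v + 1) (cols ?s1 P)"
      using v assms(4,5) by (auto simp: cols_def row_def mem_dedges)
    moreover have "(v, v + 1) \<notin> cols ?s1 P" using v by (simp add: cols_def row_def)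
    moreover have "finite (rows ?s0 P)" "finite (cols ?s1 P)"
      using finite_dedges[OF assms(1)] by (auto simp: rows_def cols_def)
    ultimately show ?thesis by (simp add: unbalanced_def)
  qed
  show ?thesis
  proof (cases "s v")
    case True
    then have "s(v := True) = s" by (simp add: fun_upd_idem)
    with * True show ?thesis by auto
  next
    case False
    then have "s(v := False) = s" by (simp add: fun_upd_idem)
    with * False show ?thesis by auto
  qed
qed

text \<open>Working from right to left, the orientation at the vertex where a part first appears is
  still free when all other orientations on the boundary of that part are settled.\<close>

lemma exists_unbalanced_orientation:
  assumes part: "\<And>P. P \<in> PP \<Longrightarrow> finite P" "pairwise disjnt PP" "\<Union>PP = E"
    and "a \<le> b" "{a..b} \<subseteq> E"
  shows "\<exists>s'. (\<forall>v. v \<notin> {a..<b} \<longrightarrow> s' v = s v) \<and>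
    (\<forall>P\<in>PP. P \<inter> {a..b} \<noteq> {} \<longrightarrow> a \<notin> P \<longrightarrow> unbalanced s' P)"
  using \<open>a \<le> b\<close> \<open>{a..b} \<subseteq> E\<close>
proof (induction b arbitrary: s rule: int_ge_induct)
  \<comment> \<open>With \<open>a = b\<close>, every part meeting the interval contains
    \<open>a\<close>, so the claim is vacuous.\<close>
  case base
  then show ?case by (intro exI[of _ s]) auto
next
  case (step b)
  have E: "b \<in> E" "b + 1 \<in> E" "{a..b} \<subseteq> E" using step by auto
  obtain P0 where P0: "P0 \<in> PP" "b + 1 \<in> P0" using E part(3) by blast
  have uniq: "P = P0" if "P \<in> PP" "b + 1 \<in> P" for P
    using that P0 part(2) by (auto simp: pairwise_def disjnt_def)
  show ?case
  proof (cases "P0 \<inter> {a..b} = {}")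
    case True
    then have "b \<notin> P0" using step by auto
    from unbalanced_flip[OF part(1)[OF P0(1)] E(1,2) P0(2) this, of s]
    obtain s1 where s1: "unbalanced s1 P0" "\<And>v. v \<noteq> b \<Longrightarrow> s1 v = s v"
      by (metis fun_upd_other)
    obtain s' where s': "\<forall>v. v \<notin> {a..<b} \<longrightarrow> s' v = s1 v"
        "\<forall>P\<in>PP. P \<inter> {a..b} \<noteq> {} \<longrightarrow> a \<notin> P \<longrightarrow> unbalanced s' P"
      using step.IH[OF E(3), of s1] by blast
    \<comment> \<open>The induction hypothesis alters orientations only at vertices from
      \<open>a\<close> to \<open>b - 1\<close>. A directed edge of \<open>P0\<close> with its tail
      there would come from an edge of \<open>P0\<close> in \<open>{a..b}\<close>, and there is
      none.\<close>
    have "row s' (v, w) = row s1 (v, w)" if "(v, w) \<in> dedges P0" for v w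
    proof -
      have "v \<in> P0 \<or> v + 1 \<in> P0" using that by (auto simp: mem_dedges)
      then have "v \<notin> {a..<b}" using True by force
      then show ?thesis using s'(1) by (simp add: row_def)
    qed
    then have "rows s' P0 = rows s1 P0" "cols s' P0 = cols s1 P0"
      by (auto simp: rows_def cols_def)
    then have "unbalanced s' P0" using s1 by (simp add: unbalanced_def)
    moreover have "P \<inter> {a..b} \<noteq> {} \<or> P = P0" if "P \<in> PP" "P \<inter> {a..b + 1} \<noteq> {}" for P
    proof -
      obtain i where "i \<in> P" "i \<in> {a..b + 1}" using \<open>P \<inter> {a..b + 1} \<noteq> {}\<close> by blast
      then show ?thesis using uniq[OF that(1)] by (cases "i = b + 1") auto
    qed
    moreover have "s' v = s v" if "v \<notin> {a..<b + 1}" for v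
    proof -
      have "v \<notin> {a..<b}" "v \<noteq> b" using that step by auto
      then show ?thesis using s'(1) s1(2) by simp
    qed
    ultimately show ?thesis using s'(2) by blast
  next
    case False
    obtain s' where s': "\<forall>v. v \<notin> {a..<b} \<longrightarrow> s' v = s v"
        "\<forall>P\<in>PP. P \<inter> {a..b} \<noteq> {} \<longrightarrow> a \<notin> P \<longrightarrow> unbalanced s' P"
      using step.IH[OF E(3), of s] by blast
    have "P \<inter> {a..b} \<noteq> {}" if "P \<in> PP" "P \<inter> {a..b + 1} \<noteq> {}" for P
    proof -
      obtain i where "i \<in> P" "i \<in> {a..b + 1}" using \<open>P \<inter> {a..b + 1} \<noteq> {}\<close> by blast
      then show ?thesis using uniq[OF that(1)] False by (cases "i = b + 1") auto
    qed
    then show ?thesis using s' by (intro exI[of _ s']) auto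
  qed
qed

text \<open>The pairing that \<open>flat\<close> undoes by \<open>div\<close> and
  \<open>mod\<close>. It is left unrestricted so that the same \<open>merge x\<close> can be
  restricted to each part.\<close>

definition merge :: "(int \<times> int \<Rightarrow> nat) \<Rightarrow> int \<Rightarrow> nat" where
  "merge x i = (x (i - 1, i) - 1) * n + x (i, i - 1)"

lemma merge_in_cube:
  assumes "x \<in> cube (dedges E) n" "D \<subseteq> E"
  shows "restrict (merge x) D \<in> cube D (n ^ 2)"
proof -
  have "merge x i \<in> {1..n ^ 2}" if "i \<in> D" for i
  proof -
    have "(i - 1, i) \<in> dedges E" "(i, i - 1) \<in> dedges E" using that assms(2) by (auto simp: mem_dedges)
    then have x: "x (i - 1, i) \<in> {1..n}" "x (i, i - 1) \<in> {1..n}"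
      using assms(1) by (auto simp: cube_def PiE_iff)
    have "merge x i \<le> (n - 1) * n + n"
      unfolding merge_def using x by (intro add_mono mult_right_mono) auto
    also have "\<dots> = n ^ 2" using n by (cases n) (auto simp: power2_eq_square)
    finally show ?thesis using x by (simp add: merge_def)
  qed
  then show ?thesis by (auto simp: cube_def PiE_iff)
qed

lemma flat_merge:
  assumes x: "x \<in> cube (dedges E) n"
  shows "flat n E A (restrict (merge x) E) = A x"
proof -
  have "(if d \<in> dedges E then
       (if snd d = fst d + 1 then (restrict (merge x) E (snd d) - 1) div n + 1
        else (restrict (merge x) E (fst d) - 1) mod n + 1) else undefined) = x d" for d
  proof (cases "d \<in> dedges E")
    case False
    then show ?thesis using x PiE_arb[of x "dedges E" _ d] by (simp add: cube_def)
  next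
    case True
    have dm: "(merge x i - 1) div n + 1 = x (i - 1, i)" "(merge x i - 1) mod n + 1 = x (i, i - 1)"
      if "i \<in> E" for i
    proof -
      have "(i - 1, i) \<in> dedges E" "(i, i - 1) \<in> dedges E" using that by (auto simp: mem_dedges)
      then have r: "x (i - 1, i) \<in> {1..n}" "x (i, i - 1) \<in> {1..n}"
        using x by (auto simp: cube_def PiE_iff)
      then have "merge x i - 1 = (x (i, i - 1) - 1) + (x (i - 1, i) - 1) * n"
        by (simp add: merge_def)
      moreover have "x (i, i - 1) - 1 < n" using r by auto
      moreover have "(u + v * n) div n = v \<and> (u + v * n) mod n = u" if "u < n" for u v
        using that by simp
      ultimately have "(merge x i - 1) div n = x (i - 1, i) - 1" "(merge x i - 1) mod n = x (i, i - 1) - 1"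
        by presburger+
      then show "(merge x i - 1) div n + 1 = x (i - 1, i)" "(merge x i - 1) mod n + 1 = x (i, i - 1)"
        using r by auto
    qed
    obtain v w where d: "d = (v, w)" by (cases d)
    from True d consider "w = v + 1" "v + 1 \<in> E" | "w = v - 1" "v \<in> E" by (auto simp: mem_dedges)
    then show ?thesis
    proof cases
      case 1
      then show ?thesis using True d dm(1)[of "v + 1"] by simp
    next
      case 2
      then show ?thesis using True d dm(2)[of v] by simp
    qed
  qed
  then show ?thesis by (simp add: flat_def)
qed

lemma relrk_product_le:
  fixes c :: "int set \<Rightarrow> (int \<Rightarrow> nat) \<Rightarrow> 'f::field"
  assumes part: "pairwise disjnt PP" "\<Union>PP = E" and "a \<le> b" "{a..b} \<subseteq> E"
    and q: "card {P\<in>PP. P \<inter> {a..b} \<noteq> {}} = Suc q"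
  shows "\<exists>\<alpha>\<in>Pairs (V2 V E).
    relrk n V E \<alpha> \<gamma> (\<lambda>x. \<Prod>P\<in>PP. c P (restrict (merge x) P)) \<le> 1 / real n ^ q"
proof -
  have finPP: "finite PP" using part(2) finite_E by (intro finite_UnionD) simp
  have finP: "finite P" if "P \<in> PP" for P
    using that part(2) by (intro finite_subset[OF _ finite_E]) auto
  obtain s where s: "\<forall>P\<in>PP. P \<inter> {a..b} \<noteq> {} \<longrightarrow> a \<notin> P \<longrightarrow> unbalanced s P"
    using exists_unbalanced_orientation[of PP a b, OF finP part \<open>a \<le> b\<close> \<open>{a..b} \<subseteq> E\<close>] by blast
  define w where "w P = (if card (rows s P) \<le> card (cols s P) then rows s P else cols s P)" for P
  define W where "W = (\<Union>P\<in>PP. w P)"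
  \<comment> \<open>The two sides of \<open>P\<close> together have \<open>2 * card P\<close>
    elements, so the smaller one has at most \<open>card P\<close>, and at least one fewer if the
    sides differ in size.\<close>
  have w: "card (w P) + of_bool (unbalanced s P) \<le> card P" if "P \<in> PP" for P
    using card_rows_cols[OF finP[OF that], of s] by (auto simp: w_def unbalanced_def)
  have "q \<le> card {P\<in>PP. unbalanced s P}"
  proof -
    have "a \<in> \<Union>PP" using part(2) \<open>a \<le> b\<close> \<open>{a..b} \<subseteq> E\<close> by auto
    then obtain Pa where Pa: "Pa \<in> PP" "a \<in> Pa" by auto
    \<comment> \<open>Among the parts meeting the interval only the one containing \<open>a\<close>
      may be balanced; hence the loss from \<open>Suc q\<close> to \<open>q\<close>.\<close>
    have "{P\<in>PP. P \<inter> {a..b} \<noteq> {}} \<subseteq> insert Pa {P\<in>PP. unbalanced s P}"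
    proof
      fix P assume P: "P \<in> {P\<in>PP. P \<inter> {a..b} \<noteq> {}}"
      show "P \<in> insert Pa {P\<in>PP. unbalanced s P}"
      proof (cases "a \<in> P")
        case True
        then have "P = Pa" using P Pa part(1) by (auto simp: pairwise_def disjnt_def)
        then show ?thesis by simp
      qed (use P s in auto)
    qed
    then have "Suc q \<le> card (insert Pa {P\<in>PP. unbalanced s P})"
      unfolding q[symmetric] using finPP by (intro card_mono) auto
    also have "\<dots> \<le> Suc (card {P\<in>PP. unbalanced s P})" by (rule card_insert_le_m1) simp_all
    finally show ?thesis by simp
  qed
  moreover have "card W \<le> (\<Sum>P\<in>PP. card (w P))"
    unfolding W_def using finPP by (intro card_UN_le)
  moreover have "(\<Sum>P\<in>PP. card (w P)) + card {P\<in>PP. unbalanced s P}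
      = (\<Sum>P\<in>PP. card (w P) + of_bool (unbalanced s P))"
    using finPP by (simp add: sum.distrib Int_def)
  moreover have "\<dots> \<le> (\<Sum>P\<in>PP. card P)" using w by (intro sum_mono)
  moreover have "(\<Sum>P\<in>PP. card P) = card E"
    using card_Union_disjoint[OF part(1)] finP part(2) by simp
  ultimately have card: "card W + q \<le> card E" by linarith
  let ?A = "\<lambda>x. \<Prod>P\<in>PP. c P (restrict (merge x) P)"
  have "flattening_rank n (rows s E) (cols s E) ?A \<le> n ^ card W"
  proof (rule flattening_rank_prod_le[where PP = PP and T = dedges
        and g = "\<lambda>P x. c P (restrict (merge x) P)"])
    show "finite (rows s E)" "finite (cols s E)"
      using finite_dedges[OF finite_E] by (auto simp: rows_def cols_def)
    show "rows s E \<inter> cols s E = {}" by (auto simp: rows_def cols_def)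
    show "rows s E \<inter> dedges P \<subseteq> W \<or> cols s E \<inter> dedges P \<subseteq> W" if "P \<in> PP" for P
    proof (cases "card (rows s P) \<le> card (cols s P)")
      case True
      then have "rows s P \<subseteq> W" using that by (force simp: W_def w_def)
      then show ?thesis by (auto simp: rows_def)
    next
      case False
      then have "cols s P \<subseteq> W" using that by (force simp: W_def w_def)
      then show ?thesis by (auto simp: cols_def)
    qed
    show sub: "dedges P \<subseteq> rows s E \<union> cols s E" if "P \<in> PP" for P
      using that part(2) by (auto simp: rows_def cols_def dedges_def)
    show "W \<subseteq> rows s E \<union> cols s E"
    proof
      fix d assume "d \<in> W"
      then obtain P where "P \<in> PP" "d \<in> dedges P"
        by (auto simp: W_def w_def rows_def cols_def split: if_splits)
      then show "d \<in> rows s E \<union> cols s E" using sub by blast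
    qed
    show "c P (restrict (merge x) P) = c P (restrict (merge y) P)"
      if "\<And>d. d \<in> dedges P \<Longrightarrow> x d = y d" for P x y
    proof -
      have "merge x i = merge y i" if "i \<in> P" for i
        using that \<open>\<And>d. d \<in> dedges P \<Longrightarrow> x d = y d\<close> by (simp add: merge_def mem_dedges)
      then have "restrict (merge x) P = restrict (merge y) P" by (auto simp: restrict_def)
      then show ?thesis by simp
    qed
  qed (use finPP in auto)
  from of_nat_mono[OF this]
  have "real (flattening_rank n (rows s E) (cols s E) ?A) \<le> real n ^ card W"
    by (simp only: of_nat_power)
  then have "relrk n V E (orient s) \<gamma> ?A \<le> real n ^ card W / real n ^ card E"
    unfolding relrk_orient by (rule divide_right_mono) simp
  also have "\<dots> \<le> 1 / real n ^ q"
  proof -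
    have "real n ^ (card W + q) \<le> real n ^ card E" using n card by (intro power_increasing) auto
    then show ?thesis using n by (simp add: field_simps power_add)
  qed
  finally show ?thesis using orient_in_Pairs by blast
qed

subsection \<open>Descent along a branch of the formula\<close>

text \<open>An explicit family witnesses that the inner minimum in \<open>rho\<close> is at most
  \<open>t\<close>. Witnesses can be added term by term without handling infima.\<close>

definition decomposable :: "((int \<times> int \<Rightarrow> nat) \<Rightarrow> 'f::field) \<Rightarrow> real \<Rightarrow> bool" where
  "decomposable F t \<longleftrightarrow> (\<exists>X. (\<forall>x\<in>cube (dedges E) n. F x = (\<Sum>\<alpha>\<in>Pairs (V2 V E). X \<alpha> x)) \<and>
    (\<Sum>\<alpha>\<in>Pairs (V2 V E). relrk n V E \<alpha> \<gamma> (X \<alpha>)) \<le> t)"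

lemma decomposable_mono: "\<lbrakk>decomposable F t; t \<le> u\<rbrakk> \<Longrightarrow> decomposable F u"
  unfolding decomposable_def by (elim exE conjE) (intro exI conjI, assumption, rule order_trans)

lemma decomposable_cong:
  "\<lbrakk>decomposable F t; \<And>x. x \<in> cube (dedges E) n \<Longrightarrow> F x = G x\<rbrakk> \<Longrightarrow> decomposable G t"
  unfolding decomposable_def by (simp cong: ball_cong)

lemma finite_V2: "finite (V2 V E)"
  using finite_V by (simp add: V2_def)

lemma finite_row_set:
  assumes "\<alpha> \<in> Pairs (V2 V E)"
  shows "finite (fst \<alpha> \<union> (fst \<gamma> \<inter> D1 V E))"
proof -
  define U where "U = (\<lambda>v. (v, v + 1)) ` V2 V E \<union> (\<lambda>v::int. (v, v - 1)) ` V2 V E"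
  have "fst \<alpha> \<subseteq> path_dedges" "\<forall>d\<in>fst \<alpha>. fst d \<in> V2 V E"
    using assms by (auto simp: Pairs_def)
  then have "fst \<alpha> \<subseteq> U" by (force simp: path_dedges_def U_def image_iff)
  moreover have "finite U" using finite_V2 by (simp add: U_def)
  moreover have "finite (D1 V E)" using finite_dedges[OF finite_E] by (simp add: D1_def)
  ultimately show ?thesis using finite_subset by auto
qed

lemma relrk_zero:
  assumes "\<alpha> \<in> Pairs (V2 V E)"
  shows "relrk n V E \<alpha> \<gamma> (\<lambda>x. 0) = 0"
  by (simp add: relrk_def flattening_rank_zero[OF finite_row_set[OF assms]])

lemma relrk_sum:
  fixes m :: nat
  assumes "\<alpha> \<in> Pairs (V2 V E)"
  shows "relrk n V E \<alpha> \<gamma> (\<lambda>x. \<Sum>i<m. X i x) \<le> (\<Sum>i<m. relrk n V E \<alpha> \<gamma> (X i))"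
proof -
  let ?I = "fst \<alpha> \<union> (fst \<gamma> \<inter> D1 V E)" and ?J = "snd \<alpha> \<union> (snd \<gamma> \<inter> D1 V E)"
  have "real (flattening_rank n ?I ?J (\<lambda>x. \<Sum>i<m. X i x)) \<le> real (\<Sum>i<m. flattening_rank n ?I ?J (X i))"
    using flattening_rank_sum[OF finite_row_set[OF assms]] by (simp only: of_nat_le_iff)
  then have "relrk n V E \<alpha> \<gamma> (\<lambda>x. \<Sum>i<m. X i x)
      \<le> real (\<Sum>i<m. flattening_rank n ?I ?J (X i)) / real n ^ card E"
    unfolding relrk_def by (intro divide_right_mono) auto
  then show ?thesis by (simp add: relrk_def sum_divide_distrib)
qed

text \<open>The families are added separately for each \<alpha>. The tensors added then share their
  rows and columns, so subadditivity of rank applies.\<close>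

lemma decomposable_sum:
  fixes m :: nat
  assumes "\<And>i. i < m \<Longrightarrow> decomposable (F i) (t i)"
  shows "decomposable (\<lambda>x. \<Sum>i<m. F i x) (\<Sum>i<m. t i)"
proof -
  have "\<forall>i\<in>{..<m}. \<exists>X. (\<forall>x\<in>cube (dedges E) n. F i x = (\<Sum>\<alpha>\<in>Pairs (V2 V E). X \<alpha> x)) \<and>
      (\<Sum>\<alpha>\<in>Pairs (V2 V E). relrk n V E \<alpha> \<gamma> (X \<alpha>)) \<le> t i"
    using assms unfolding decomposable_def by simp
  then obtain X where X: "\<forall>i\<in>{..<m}. (\<forall>x\<in>cube (dedges E) n. F i x = (\<Sum>\<alpha>\<in>Pairs (V2 V E). X i \<alpha> x)) \<and>
      (\<Sum>\<alpha>\<in>Pairs (V2 V E). relrk n V E \<alpha> \<gamma> (X i \<alpha>)) \<le> t i"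
    by (auto dest!: bchoice)
  define Y where "Y \<alpha> x = (\<Sum>i<m. X i \<alpha> x)" for \<alpha> x
  have "(\<Sum>i<m. F i x) = (\<Sum>\<alpha>\<in>Pairs (V2 V E). Y \<alpha> x)" if "x \<in> cube (dedges E) n" for x
    using X that by (simp add: Y_def sum.swap[of _ _ "{..<m}"])
  moreover have "(\<Sum>\<alpha>\<in>Pairs (V2 V E). relrk n V E \<alpha> \<gamma> (Y \<alpha>)) \<le> (\<Sum>i<m. t i)"
  proof -
    have "(\<Sum>\<alpha>\<in>Pairs (V2 V E). relrk n V E \<alpha> \<gamma> (Y \<alpha>))
        \<le> (\<Sum>\<alpha>\<in>Pairs (V2 V E). \<Sum>i<m. relrk n V E \<alpha> \<gamma> (X i \<alpha>))"
      unfolding Y_def by (intro sum_mono relrk_sum)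
    also have "\<dots> = (\<Sum>i<m. \<Sum>\<alpha>\<in>Pairs (V2 V E). relrk n V E \<alpha> \<gamma> (X i \<alpha>))"
      by (rule sum.swap)
    also have "\<dots> \<le> (\<Sum>i<m. t i)" using X by (intro sum_mono) auto
    finally show ?thesis .
  qed
  ultimately show ?thesis unfolding decomposable_def by blast
qed

lemma decomposable_single:
  assumes "\<alpha> \<in> Pairs (V2 V E)" "relrk n V E \<alpha> \<gamma> F \<le> t"
  shows "decomposable F t"
proof -
  define X where "X \<beta> = (if \<beta> = \<alpha> then F else (\<lambda>x. 0))" for \<beta>
  have fin: "finite (Pairs (V2 V E))" using finite_Pairs finite_V2 by blast
  have "F x = (\<Sum>\<beta>\<in>Pairs (V2 V E). X \<beta> x)" for x
    using fin assms(1) by (subst sum.remove[of _ \<alpha>]) (auto simp: X_def)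
  moreover have "(\<Sum>\<beta>\<in>Pairs (V2 V E). relrk n V E \<beta> \<gamma> (X \<beta>)) = relrk n V E \<alpha> \<gamma> F"
    using fin assms(1) by (subst sum.remove[of _ \<alpha>]) (auto simp: X_def relrk_zero)
  ultimately show ?thesis using assms(2) unfolding decomposable_def by (intro exI[of _ X]) simp
qed

text \<open>Serves the leaves with a vanishing tensor, for which \<open>lsm_aux\<close> charges
  nothing.\<close>

lemma decomposable_zero:
  assumes "\<And>x. x \<in> cube (dedges E) n \<Longrightarrow> F x = 0" "0 \<le> t"
  shows "decomposable F t"
proof -
  have "decomposable (\<lambda>x. 0) t"
    using assms(2) by (intro decomposable_single[OF orient_in_Pairs]) (simp add: relrk_zero orient_in_Pairs)
  then show ?thesis by (rule decomposable_cong) (simp add: assms)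
qed

text \<open>The leaf \<open>D\<close> is itself a part meeting the interval, so the product has one
  such part more than \<open>PP\<close>, and the number of those in \<open>PP\<close> is the
  exponent. The leaf consists of a single edge of the interval, so the logarithm vanishes.\<close>

lemma decomposable_leaf:
  fixes B :: "(int \<Rightarrow> nat) \<Rightarrow> 'f::field" and c :: "int set \<Rightarrow> (int \<Rightarrow> nat) \<Rightarrow> 'f"
  assumes ab: "a \<le> b" "{a..b} \<subseteq> E" and D: "card D \<le> 1" "D \<inter> {a..b} \<noteq> {}"
    and PP: "pairwise disjnt PP" "D \<inter> \<Union>PP = {}" "D \<union> \<Union>PP = E"
  shows "decomposable (\<lambda>x. B (restrict (merge x) D) * (\<Prod>P\<in>PP. c P (restrict (merge x) P)))
    (real (if \<exists>y\<in>cube D (n ^ 2). B y \<noteq> 0 then 1 else 0) /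
      real n powr (real (card {P\<in>PP. P \<inter> {a..b} \<noteq> {}}) + log 2 (real (card (D \<inter> {a..b})))))"
proof (cases "\<exists>y\<in>cube D (n ^ 2). B y \<noteq> 0")
  case False
  have "D \<subseteq> E" using PP by auto
  then show ?thesis using False merge_in_cube by (intro decomposable_zero) auto
next
  case True
  have "finite (D \<union> \<Union>PP)" unfolding PP(3) by (rule finite_E)
  then have finD: "finite D" and finPP: "finite PP" by (auto intro: finite_UnionD)
  define q where "q = card {P\<in>PP. P \<inter> {a..b} \<noteq> {}}"
  have "D \<notin> PP" using PP(2) D(2) by auto
  have "card (D \<inter> {a..b}) = 1"
  proof -
    have "card (D \<inter> {a..b}) \<le> card D" using finD by (intro card_mono) auto
    moreover have "card (D \<inter> {a..b}) \<noteq> 0" using D(2) finD by simp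
    ultimately show ?thesis using D(1) by linarith
  qed
  have "{P\<in>insert D PP. P \<inter> {a..b} \<noteq> {}} = insert D {P\<in>PP. P \<inter> {a..b} \<noteq> {}}"
    using D(2) by auto
  then have q: "card {P\<in>insert D PP. P \<inter> {a..b} \<noteq> {}} = Suc q"
    using finPP \<open>D \<notin> PP\<close> by (simp add: q_def)
  have dis: "pairwise disjnt (insert D PP)"
    using PP(1,2) by (auto simp: pairwise_insert disjnt_def)
  have "\<Union>(insert D PP) = E" using PP(3) by simp
  from relrk_product_le[OF dis this ab q, of "c(D := B)"] obtain \<alpha> where \<alpha>: "\<alpha> \<in> Pairs (V2 V E)"
    "relrk n V E \<alpha> \<gamma> (\<lambda>x. \<Prod>P\<in>insert D PP. (c(D := B)) P (restrict (merge x) P)) \<le> 1 / real n ^ q"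
    by blast
  have "(\<Prod>P\<in>insert D PP. (c(D := B)) P (restrict (merge x) P))
      = B (restrict (merge x) D) * (\<Prod>P\<in>PP. c P (restrict (merge x) P))" for x
  proof -
    have "(\<Prod>P\<in>PP. (c(D := B)) P (restrict (merge x) P)) = (\<Prod>P\<in>PP. c P (restrict (merge x) P))"
      using \<open>D \<notin> PP\<close> by (intro prod.cong) auto
    then show ?thesis using finPP \<open>D \<notin> PP\<close> by simp
  qed
  with \<alpha>(2) have "relrk n V E \<alpha> \<gamma>
      (\<lambda>x. B (restrict (merge x) D) * (\<Prod>P\<in>PP. c P (restrict (merge x) P))) \<le> 1 / real n ^ q"
    by simp
  then show ?thesis
    using n True \<open>card (D \<inter> {a..b}) = 1\<close>
    by (intro decomposable_single[OF \<alpha>(1)]) (simp add: q_def[symmetric] powr_realpow)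
qed

text \<open>The descent keeps track of one subformula, for \<open>B\<close> on the edge set \<open>D\<close>, while the factors
  split off on the way are arbitrary tensors on the parts in \<open>PP\<close>. Passing to the child that
  retains more edges of the interval at most halves their number, but adds a part meeting the
  interval, unless the other child misses the interval altogether.\<close>

lemma decomposable_descent:
  fixes B :: "(int \<Rightarrow> nat) \<Rightarrow> 'f::field" and c :: "int set \<Rightarrow> (int \<Rightarrow> nat) \<Rightarrow> 'f"
  assumes ab: "a \<le> b" "{a..b} \<subseteq> E"
    and "card D \<le> Suc k" "D \<inter> {a..b} \<noteq> {}"
    and "pairwise disjnt PP" "D \<inter> \<Union>PP = {}" "D \<union> \<Union>PP = E"
  shows "decomposable (\<lambda>x. B (restrict (merge x) D) * (\<Prod>P\<in>PP. c P (restrict (merge x) P)))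
    (real (lsm_aux k (n ^ 2) D B) /
      real n powr (real (card {P\<in>PP. P \<inter> {a..b} \<noteq> {}}) + log 2 (real (card (D \<inter> {a..b})))))"
  using assms(3-)
proof (induction k arbitrary: D B PP c)
  case (0 D B PP c)
  \<comment> \<open>At depth 0 \<open>lsm_aux\<close> applies the leaf rule whatever the size of
    \<open>D\<close>; the bound \<open>card D \<le> Suc k\<close> guarantees that \<open>D\<close>
    really is a leaf.\<close>
  have "card D \<le> 1" using 0 by simp
  from decomposable_leaf[OF ab this 0(2-5)] show ?case by (simp only: lsm_aux.simps(1))
next
  case (Suc k D B PP c)
  show ?case
  proof (cases "card D \<le> 1")
    case True
    from decomposable_leaf[OF ab True Suc.prems(2-5)] show ?thesis
      by (simp only: lsm_aux.simps(2) True if_True)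
  next
    case False
    have "finite (D \<union> \<Union>PP)" unfolding Suc.prems(5) by (rule finite_E)
    then have finD: "finite D" and finPP: "finite PP" by (auto intro: finite_UnionD)
    let ?K = "{a..b}" and ?R = "\<lambda>x. \<Prod>P\<in>PP. c P (restrict (merge x) P)"
    define w where "w = real (card {P\<in>PP. P \<inter> ?K \<noteq> {}}) + log 2 (real (card (D \<inter> ?K)))"
    \<comment> \<open>\<open>D'\<close> is the child that is entered. Its sibling \<open>D''\<close>
      becomes a new part, and the factor \<open>C'\<close> on it is kept as an arbitrary
      tensor.\<close>
    have child: "decomposable (\<lambda>x. B' (restrict (merge x) D') * C' (restrict (merge x) D'') * ?R x)
        (real (lsm_aux k (n ^ 2) D' B') / real n powr w)"
      if D': "D' \<union> D'' = D" "D' \<inter> D'' = {}" "D'' \<noteq> {}" "card (D'' \<inter> ?K) \<le> card (D' \<inter> ?K)"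
      for D' D'' B' C'
    proof -
      have card: "card (D \<inter> ?K) = card (D' \<inter> ?K) + card (D'' \<inter> ?K)"
      proof -
        have "D \<inter> ?K = (D' \<inter> ?K) \<union> (D'' \<inter> ?K)" using D' by auto
        then show ?thesis using D'(2) by (simp only:) (rule card_Un_disjoint, auto)
      qed
      have "card (D \<inter> ?K) \<noteq> 0" using Suc.prems(2) finD by simp
      then have pos: "card (D' \<inter> ?K) \<ge> 1" using card D'(4) by linarith
      have "D'' \<notin> PP" using D' Suc.prems(4) by auto
      have "D' \<subset> D" using D' by auto
      then have "card D' < card D" using finD by (rule psubset_card_mono[rotated])
      then have "card D' \<le> Suc k" using Suc.prems(1) by simp
      moreover have "D' \<inter> ?K \<noteq> {}" using pos by auto
      moreover have "pairwise disjnt (insert D'' PP)"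
      proof -
        have "disjnt D'' P" if "P \<in> PP" for P
          using that Suc.prems(4) D'(1) by (auto simp: disjnt_def)
        then show ?thesis using Suc.prems(3) by (auto simp: pairwise_insert intro: disjnt_sym)
      qed
      moreover have "D' \<inter> \<Union>(insert D'' PP) = {}" using D'(1,2) Suc.prems(4) by auto
      moreover have "D' \<union> \<Union>(insert D'' PP) = E" using D'(1) Suc.prems(5) by auto
      ultimately have IH: "decomposable
          (\<lambda>x. B' (restrict (merge x) D') * (\<Prod>P\<in>insert D'' PP. (c(D'' := C')) P (restrict (merge x) P)))
          (real (lsm_aux k (n ^ 2) D' B') / real n powr
            (real (card {P\<in>insert D'' PP. P \<inter> ?K \<noteq> {}}) + log 2 (real (card (D' \<inter> ?K)))))"
        by (rule Suc.IH)
      have prod: "(\<Prod>P\<in>insert D'' PP. (c(D'' := C')) P (restrict (merge x) P))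
          = C' (restrict (merge x) D'') * ?R x" for x
      proof -
        have "(\<Prod>P\<in>PP. (c(D'' := C')) P (restrict (merge x) P)) = ?R x"
          using \<open>D'' \<notin> PP\<close> by (intro prod.cong) auto
        then show ?thesis using finPP \<open>D'' \<notin> PP\<close> by simp
      qed
      \<comment> \<open>If \<open>D''\<close> meets the interval, the number of parts grows by 1 and
        the logarithm drops by at most 1; otherwise both stay unchanged.\<close>
      have "w \<le> real (card {P\<in>insert D'' PP. P \<inter> ?K \<noteq> {}}) + log 2 (real (card (D' \<inter> ?K)))"
      proof (cases "D'' \<inter> ?K = {}")
        case True
        then have "{P\<in>insert D'' PP. P \<inter> ?K \<noteq> {}} = {P\<in>PP. P \<inter> ?K \<noteq> {}}" by auto
        moreover have "card (D \<inter> ?K) = card (D' \<inter> ?K)" using card True by simp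
        ultimately show ?thesis by (simp add: w_def)
      next
        case False
        then have "{P\<in>insert D'' PP. P \<inter> ?K \<noteq> {}} = insert D'' {P\<in>PP. P \<inter> ?K \<noteq> {}}" by auto
        then have "card {P\<in>insert D'' PP. P \<inter> ?K \<noteq> {}} = Suc (card {P\<in>PP. P \<inter> ?K \<noteq> {}})"
          using finPP \<open>D'' \<notin> PP\<close> by simp
        moreover have "log 2 (real (card (D \<inter> ?K))) \<le> log 2 (2 * real (card (D' \<inter> ?K)))"
          using card D'(4) pos by simp
        moreover have log2: "log 2 (2 * t) = 1 + log 2 t" if "t > 0" for t :: real
          using that by (simp add: log_mult)
        have "log 2 (2 * real (card (D' \<inter> ?K))) = 1 + log 2 (real (card (D' \<inter> ?K)))"
          by (rule log2) (use pos in linarith)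
        ultimately show ?thesis unfolding w_def by linarith
      qed
      then have "real n powr w \<le> real n powr
          (real (card {P\<in>insert D'' PP. P \<inter> ?K \<noteq> {}}) + log 2 (real (card (D' \<inter> ?K))))"
        by (rule powr_mono) (use n in simp)
      then have "real (lsm_aux k (n ^ 2) D' B') / real n powr
            (real (card {P\<in>insert D'' PP. P \<inter> ?K \<noteq> {}}) + log 2 (real (card (D' \<inter> ?K))))
          \<le> real (lsm_aux k (n ^ 2) D' B') / real n powr w"
        by (rule divide_left_mono) (use n in simp_all)
      from decomposable_mono[OF IH this] show ?thesis
        unfolding prod by (simp only: mult.assoc)
    qed
    have "card D \<ge> 2" using False by simp
    from lsm_aux_Suc_attained[OF this, of "n ^ 2" B k] obtain m :: nat and Es Fs Bs Cs where
      split: "\<forall>i<m. Es i \<noteq> {} \<and> Fs i \<noteq> {} \<and> Es i \<inter> Fs i = {} \<and> Es i \<union> Fs i = D"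
      and B: "\<forall>y\<in>cube D (n ^ 2). B y = (\<Sum>i<m. Bs i (restrict y (Es i)) * Cs i (restrict y (Fs i)))"
      and lsm: "lsm_aux (Suc k) (n ^ 2) D B
        = (\<Sum>i<m. lsm_aux k (n ^ 2) (Es i) (Bs i) + lsm_aux k (n ^ 2) (Fs i) (Cs i))"
      by (elim exE conjE) (rule that, assumption+)
    have part: "Es i \<noteq> {}" "Fs i \<noteq> {}" "Es i \<inter> Fs i = {}" "Es i \<union> Fs i = D" if "i < m" for i
      using split that by simp_all
    have "decomposable
        (\<lambda>x. Bs i (restrict (merge x) (Es i)) * Cs i (restrict (merge x) (Fs i)) * ?R x)
        (real (lsm_aux k (n ^ 2) (Es i) (Bs i) + lsm_aux k (n ^ 2) (Fs i) (Cs i)) / real n powr w)"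
      if "i < m" for i
    \<comment> \<open>The child with more edges of the interval already bounds the cost of the term;
      the size of its sibling only enlarges the bound.\<close>
    proof (cases "card (Fs i \<inter> ?K) \<le> card (Es i \<inter> ?K)")
      case True
      have "decomposable (\<lambda>x. Bs i (restrict (merge x) (Es i)) * Cs i (restrict (merge x) (Fs i)) * ?R x)
          (real (lsm_aux k (n ^ 2) (Es i) (Bs i)) / real n powr w)"
        by (rule child) (use part[OF that] True in auto)
      then show ?thesis by (rule decomposable_mono) (rule divide_right_mono, simp_all)
    next
      case False
      have "decomposable (\<lambda>x. Cs i (restrict (merge x) (Fs i)) * Bs i (restrict (merge x) (Es i)) * ?R x)
          (real (lsm_aux k (n ^ 2) (Fs i) (Cs i)) / real n powr w)"
        by (rule child) (use part[OF that] False in auto)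
      then have "decomposable (\<lambda>x. Bs i (restrict (merge x) (Es i)) * Cs i (restrict (merge x) (Fs i)) * ?R x)
          (real (lsm_aux k (n ^ 2) (Fs i) (Cs i)) / real n powr w)"
        by (rule decomposable_cong) (simp add: mult.commute)
      then show ?thesis by (rule decomposable_mono) (rule divide_right_mono, simp_all)
    qed
    from decomposable_sum[OF this] have "decomposable
        (\<lambda>x. \<Sum>i<m. Bs i (restrict (merge x) (Es i)) * Cs i (restrict (merge x) (Fs i)) * ?R x)
        (real (lsm_aux (Suc k) (n ^ 2) D B) / real n powr w)"
      unfolding lsm by (simp only: of_nat_sum sum_divide_distrib)
    then show ?thesis unfolding w_def
    proof (rule decomposable_cong)
      fix x assume x: "x \<in> cube (dedges E) n"
      have "restrict (merge x) D \<in> cube D (n ^ 2)" using merge_in_cube[OF x] Suc.prems(5) by auto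
      \<comment> \<open>These identities collapse the nested restrictions that arise when
        \<open>restrict (merge x) D\<close> is inserted into the decomposition of
        \<open>B\<close>.\<close>
      moreover have "D \<inter> Es i = Es i" "D \<inter> Fs i = Fs i" if "i < m" for i
        using part[OF that] by auto
      ultimately have "B (restrict (merge x) D)
          = (\<Sum>i<m. Bs i (restrict (merge x) (Es i)) * Cs i (restrict (merge x) (Fs i)))"
        by (simp add: B)
      then show "(\<Sum>i<m. Bs i (restrict (merge x) (Es i)) * Cs i (restrict (merge x) (Fs i)) * ?R x)
          = B (restrict (merge x) D) * ?R x"
        by (simp add: sum_distrib_right)
    qed
  qed
qed

end

section \<open>Passing from a fixed \<gamma> to the maximum in \<open>rho\<close>\<close>

theorem theorem5p11:
  fixes n :: nat and V E :: "int set" and A :: "(int \<times> int \<Rightarrow> nat) \<Rightarrow> 'f::field"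
  assumes "n \<ge> 1"
    and "finite V" and "V \<noteq> {}"
    and "path_subgraph V E"
    and "\<forall>v\<in>V. deg E v \<ge> 1"
  shows "real (lsm (n ^ 2) E (flat n E A)) \<ge> real n powr log 2 (real (ell V E)) * rho n V E A"
proof -
  obtain a b where ab: "a \<le> b" "{a..b} \<subseteq> E" "1 \<le> ell V E" "ell V E \<le> card {a..b}"
    using longest_interval[OF assms(2-5)] by blast
  define L where "L = real (lsm (n ^ 2) E (flat n E A))"
  define cost where "cost \<gamma> = Inf {(\<Sum>\<alpha>\<in>Pairs (V2 V E). relrk n V E \<alpha> \<gamma> (X \<alpha>)) | X.
        \<forall>x\<in>cube (dedges E) n. A x = (\<Sum>\<alpha>\<in>Pairs (V2 V E). X \<alpha> x)}" for \<gamma>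
  have cost: "cost \<gamma> \<le> L / real n powr log 2 (real (ell V E))" if "\<gamma> \<in> Pairs (V1 V E)" for \<gamma>
  proof -
    interpret oriented_path n V E \<gamma> using assms that by unfold_locales
    have "E \<inter> {a..b} = {a..b}" using ab by auto
    \<comment> \<open>The descent starts at the root with no factor split off, so the number of
      parts is 0; \<open>k = card E\<close> is the depth used by \<open>lsm\<close>.\<close>
    then have "decomposable (\<lambda>x. flat n E A (restrict (merge x) E)) (L / real n powr log 2 (real (card {a..b})))"
      using decomposable_descent[OF ab(1,2), where D = E and k = "card E" and PP = "{}" and B = "flat n E A"]
        ab(1) by (simp add: L_def lsm_def del: lsm_aux.simps)
    then have "decomposable A (L / real n powr log 2 (real (card {a..b})))"
      by (rule decomposable_cong) (rule flat_merge)
    then obtain X where X: "\<forall>x\<in>cube (dedges E) n. A x = (\<Sum>\<alpha>\<in>Pairs (V2 V E). X \<alpha> x)"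
      "(\<Sum>\<alpha>\<in>Pairs (V2 V E). relrk n V E \<alpha> \<gamma> (X \<alpha>)) \<le> L / real n powr log 2 (real (card {a..b}))"
      unfolding decomposable_def by blast
    have "cost \<gamma> \<le> (\<Sum>\<alpha>\<in>Pairs (V2 V E). relrk n V E \<alpha> \<gamma> (X \<alpha>))"
      unfolding cost_def
    proof (rule cInf_lower)
      \<comment> \<open>A real infimum lies below the members of its set only if the set is bounded
        below; relative ranks are nonnegative, so 0 is a bound.\<close>
      show "bdd_below {(\<Sum>\<alpha>\<in>Pairs (V2 V E). relrk n V E \<alpha> \<gamma> (X \<alpha>)) | X.
          \<forall>x\<in>cube (dedges E) n. A x = (\<Sum>\<alpha>\<in>Pairs (V2 V E). X \<alpha> x)}"
        by (rule bdd_belowI[of _ 0]) (auto simp: relrk_def intro!: sum_nonneg)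
    qed (use X(1) in blast)
    also note X(2)
    also have "L / real n powr log 2 (real (card {a..b})) \<le> L / real n powr log 2 (real (ell V E))"
    proof -
      \<comment> \<open>Here \<open>1 \<le> ell V E\<close> keeps the argument of the logarithm
        positive, where it is monotone.\<close>
      have "log 2 (real (ell V E)) \<le> log 2 (real (card {a..b}))" using ab(3,4) by simp
      then show ?thesis using assms(1)
        by (intro divide_left_mono powr_mono) (auto simp: L_def)
    qed
    finally show ?thesis .
  qed
  have "finite (Pairs (V1 V E))" using assms(2) by (intro finite_Pairs) (simp add: V1_def)
  then have "rho n V E A \<in> cost ` Pairs (V1 V E)"
    unfolding rho_def cost_def[symmetric] using Pairs_nonempty by (intro Max_in) auto
  then have "rho n V E A \<le> L / real n powr log 2 (real (ell V E))" using cost by auto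
  then show ?thesis using assms(1) by (simp add: L_def field_simps)
qed

end
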